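(* Let $n\ge 3$ and let $Br(D_n)$ be the generalized braid group (Artin group) of type $D_n$, with canonical generators $\sigma_1,\dots,\sigma_{n-1},\rho$. Put $\sigma=\sigma_1\sigma_2\cdots\sigma_{n-1}$. Then $Br(D_n)$ has a presentation with three generators $\sigma_1,\sigma,\rho$ and relations $$\begin{cases} \sigma_1\sigma^i\sigma_1\sigma^{-i}=\sigma^i\sigma_1\sigma^{-i}\sigma_1 & \text{for } 2\le i\le n/2,\\ \sigma^n=(\sigma\sigma_1)^{n-1},\\ \rho\sigma^i\sigma_1\sigma^{-i}=\sigma^i\sigma_1\sigma^{-i}\rho & \text{for } i=0,2,\dots,n-2 \ (\text{i.e. } i=0 \text{ and all } 2\le i\le n-2),\\ \rho\sigma\sigma_1\sigma^{-1}\rho=\sigma\sigma_1\sigma^{-1}\rho\sigma\sigma_1\sigma^{-1}. \end{cases}$$ Moreover, adding the relations $\sigma_1^2=1$ and $\rho^2=1$ to these gives a presentation of the Coxeter group of type $D_n$.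
   Context: The braid group of type $D_n$ is the group with generators $\sigma_i$, $i=1,\dots,n-1$, and $\rho$, and relations: $\sigma_i\sigma_j=\sigma_j\sigma_i$ if $|i-j|>1$; $\sigma_i\sigma_{i+1}\sigma_i=\sigma_{i+1}\sigma_i\sigma_{i+1}$ for $1\le i\le n-2$; $\rho\sigma_i=\sigma_i\rho$ if $i=1,3,\dots,n-1$ (i.e. all $i\neq 2$); $\rho\sigma_2\rho=\sigma_2\rho\sigma_2$. The Coxeter group of type $D_n$ is its quotient by the additional relations that the squares of all canonical generators $\sigma_1,\dots,\sigma_{n-1},\rho$ are trivial. *)

theory Defs
  imports "HOL-Algebra.Group"
begin

section \<open>Groups given by generators and relations\<close>

text \<open>A letter \<^term>\<open>(x, True)\<close> stands for the generator \<^term>\<open>x\<close>, and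
  \<^term>\<open>(x, False)\<close> for its formal inverse. The product of words is \<^term>\<open>(@)\<close>.\<close>

type_synonym 'x word = "('x \<times> bool) list"

definition words :: "'x set \<Rightarrow> 'x word set" where
  "words X = lists (X \<times> UNIV)"

definition gen :: "'x \<Rightarrow> 'x word" where
  "gen x = [(x, True)]"

definition winv :: "'x word \<Rightarrow> 'x word" where
  "winv w = rev (map (\<lambda>(x, b). (x, \<not> b)) w)"

definition wpow :: "'x word \<Rightarrow> nat \<Rightarrow> 'x word" where
  "wpow w k = concat (replicate k w)"

text \<open>A relation \<open>u = v\<close> between words is the pair \<^term>\<open>(u, v)\<close>. The following is the least
  congruence on the words over \<open>X\<close> that contains the relations \<open>R\<close> and free cancellation.\<close>

inductive pres_eq :: "'x set \<Rightarrow> ('x word \<times> 'x word) set \<Rightarrow> 'x word \<Rightarrow> 'x word \<Rightarrow> bool"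
  for X R where
  refl: "w \<in> words X \<Longrightarrow> pres_eq X R w w"
| sym: "pres_eq X R u v \<Longrightarrow> pres_eq X R v u"
| trans: "pres_eq X R u v \<Longrightarrow> pres_eq X R v w \<Longrightarrow> pres_eq X R u w"
| cong: "pres_eq X R u u' \<Longrightarrow> pres_eq X R v v' \<Longrightarrow> pres_eq X R (u @ v) (u' @ v')"
| cancel: "x \<in> X \<Longrightarrow> pres_eq X R [(x, b), (x, \<not> b)] []"
| rel: "(u, v) \<in> R \<Longrightarrow> u \<in> words X \<Longrightarrow> v \<in> words X \<Longrightarrow> pres_eq X R u v"

definition pres_class :: "'x set \<Rightarrow> ('x word \<times> 'x word) set \<Rightarrow> 'x word \<Rightarrow> 'x word set" where
  "pres_class X R w = {v. pres_eq X R w v}"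

definition presented_group :: "'x set \<Rightarrow> ('x word \<times> 'x word) set \<Rightarrow> 'x word set monoid" where
  "presented_group X R =
    \<lparr>carrier = pres_class X R ` words X,
     mult = (\<lambda>A B. {w. \<exists>u\<in>A. \<exists>v\<in>B. pres_eq X R (u @ v) w}),
     one = pres_class X R []\<rparr>"

text \<open>\<^term>\<open>has_presentation G X R f\<close>: the elements \<^term>\<open>f x\<close> of \<open>G\<close>, for \<^term>\<open>x \<in> X\<close>, generate
  \<open>G\<close>, with defining relations \<open>R\<close>.\<close>

definition has_presentation ::
    "('a, 'm) monoid_scheme \<Rightarrow> 'x set \<Rightarrow> ('x word \<times> 'x word) set \<Rightarrow> ('x \<Rightarrow> 'a) \<Rightarrow> bool" where
  "has_presentation G X R f \<longleftrightarrow>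
     group G \<and> R \<subseteq> words X \<times> words X \<and>
     (\<exists>\<phi> \<in> iso (presented_group X R) G. \<forall>x\<in>X. \<phi> (pres_class X R (gen x)) = f x)"


subsection \<open>The presented group is a group\<close>

lemma words_Nil [simp]: "[] \<in> words X"
  by (simp add: words_def)

lemma words_append [simp]: "u @ v \<in> words X \<longleftrightarrow> u \<in> words X \<and> v \<in> words X"
  by (auto simp: words_def)

lemma words_Cons [simp]: "(x, b) # w \<in> words X \<longleftrightarrow> x \<in> X \<and> w \<in> words X"
  by (auto simp: words_def)

lemma words_gen [simp]: "gen x \<in> words X \<longleftrightarrow> x \<in> X"
  by (simp add: gen_def)

lemma winv_Nil [simp]: "winv [] = []"
  by (simp add: winv_def)

lemma winv_Cons [simp]: "winv ((x, b) # w) = winv w @ [(x, \<not> b)]"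
  by (simp add: winv_def)

lemma words_winv [simp]: "w \<in> words X \<Longrightarrow> winv w \<in> words X"
  by (induction w) auto

lemma words_wpow [simp]: "w \<in> words X \<Longrightarrow> wpow w k \<in> words X"
  by (induction k) (auto simp: wpow_def)

lemma pres_eq_words:
  assumes "pres_eq X R u v"
  shows "u \<in> words X" "v \<in> words X"
  using assms by (induction rule: pres_eq.induct) auto

lemma pres_class_eq_iff:
  assumes "u \<in> words X"
  shows "pres_class X R u = pres_class X R v \<longleftrightarrow> pres_eq X R u v"
  using assms unfolding pres_class_def
  by (auto intro: pres_eq.intros dest: pres_eq.sym pres_eq.trans)

lemma pres_class_mult:
  assumes "u \<in> words X" "v \<in> words X"
  shows "pres_class X R u \<otimes>\<^bsub>presented_group X R\<^esub> pres_class X R v = pres_class X R (u @ v)"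
  using assms unfolding pres_class_def presented_group_def
  by (auto intro: pres_eq.refl pres_eq.trans pres_eq.cong)

lemma pres_eq_winv:
  assumes "w \<in> words X"
  shows "pres_eq X R (winv w @ w) []"
  using assms
proof (induction w)
  case Nil
  then show ?case by (simp add: pres_eq.refl)
next
  case (Cons a w)
  obtain x b where a: "a = (x, b)" by force
  have x: "x \<in> X" and w: "w \<in> words X" using Cons.prems a by auto
  have "pres_eq X R ([(x, \<not> b), (x, b)]) []"
    using pres_eq.cancel[OF x, of R "\<not> b"] by simp
  then have "pres_eq X R (winv w @ ([(x, \<not> b), (x, b)] @ w)) (winv w @ ([] @ w))"
    using w by (intro pres_eq.cong pres_eq.refl) auto
  then show ?case using Cons.IH[OF w] a by (auto intro: pres_eq.trans)
qed

lemma carrier_presented_group: "carrier (presented_group X R) = pres_class X R ` words X"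
  by (simp add: presented_group_def)

lemma one_presented_group: "\<one>\<^bsub>presented_group X R\<^esub> = pres_class X R []"
  by (simp add: presented_group_def)

lemma group_presented_group: "group (presented_group X R)"
proof (rule groupI)
  fix A assume "A \<in> carrier (presented_group X R)"
  then obtain w where w: "w \<in> words X" "A = pres_class X R w"
    by (auto simp: carrier_presented_group)
  have "pres_class X R (winv w) \<otimes>\<^bsub>presented_group X R\<^esub> A = \<one>\<^bsub>presented_group X R\<^esub>"
    using w pres_eq_winv[OF w(1), of R]
    by (simp add: pres_class_mult one_presented_group pres_class_eq_iff)
  then show "\<exists>B\<in>carrier (presented_group X R).
      B \<otimes>\<^bsub>presented_group X R\<^esub> A = \<one>\<^bsub>presented_group X R\<^esub>"
    using w by (auto simp: carrier_presented_group)
qed (auto simp: carrier_presented_group one_presented_group pres_class_mult)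


subsection \<open>The universal property\<close>

definition word_eval :: "('a, 'm) monoid_scheme \<Rightarrow> ('x \<Rightarrow> 'a) \<Rightarrow> 'x word \<Rightarrow> 'a" where
  "word_eval G f w =
     foldr (\<lambda>(x, b) a. (if b then f x else inv\<^bsub>G\<^esub> f x) \<otimes>\<^bsub>G\<^esub> a) w \<one>\<^bsub>G\<^esub>"

context group
begin

lemma word_eval_Nil [simp]: "word_eval G f [] = \<one>"
  by (simp add: word_eval_def)

lemma word_eval_Cons [simp]:
  "word_eval G f ((x, b) # w) = (if b then f x else inv f x) \<otimes> word_eval G f w"
  by (simp add: word_eval_def)

lemma word_eval_closed:
  assumes "f \<in> X \<rightarrow> carrier G" "w \<in> words X"
  shows "word_eval G f w \<in> carrier G"
  using assms(2) by (induction w) (use assms(1) in \<open>auto simp: Pi_iff\<close>)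

lemma word_eval_append:
  assumes "f \<in> X \<rightarrow> carrier G" "u \<in> words X" "v \<in> words X"
  shows "word_eval G f (u @ v) = word_eval G f u \<otimes> word_eval G f v"
  using assms(2)
proof (induction u)
  case Nil
  then show ?case using word_eval_closed[OF assms(1,3)] by simp
next
  case (Cons a u)
  obtain x b where a: "a = (x, b)" by force
  have "x \<in> X" "u \<in> words X" using Cons.prems a by auto
  then show ?case
    using Cons.IH a assms(1) word_eval_closed[OF assms(1)] assms(3)
    by (auto simp: m_assoc Pi_iff)
qed

lemma word_eval_pres_eq:
  assumes f: "f \<in> X \<rightarrow> carrier G"
    and R: "\<And>u v. (u, v) \<in> R \<Longrightarrow> word_eval G f u = word_eval G f v"
    and "pres_eq X R u v"
  shows "word_eval G f u = word_eval G f v"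
  using assms(3)
proof (induction rule: pres_eq.induct)
  case (cong u u' v v')
  then show ?case by (simp add: word_eval_append[OF f] pres_eq_words)
next
  case (cancel x b)
  then have "f x \<in> carrier G" using f by auto
  then show ?case by simp
qed (auto simp: R)

theorem presented_group_universal:
  assumes f: "f \<in> X \<rightarrow> carrier G"
    and R: "\<And>u v. (u, v) \<in> R \<Longrightarrow> word_eval G f u = word_eval G f v"
  shows "\<exists>h \<in> hom (presented_group X R) G.
           \<forall>w\<in>words X. h (pres_class X R w) = word_eval G f w"
proof -
  define h where "h A = word_eval G f (SOME w. w \<in> A)" for A
  have h: "h (pres_class X R w) = word_eval G f w" if w: "w \<in> words X" for w
  proof -
    have "w \<in> pres_class X R w" using w by (simp add: pres_class_def pres_eq.refl)
    then have "(SOME w'. w' \<in> pres_class X R w) \<in> pres_class X R w" by (rule someI)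
    then have "pres_eq X R w (SOME w'. w' \<in> pres_class X R w)"
      by (simp add: pres_class_def)
    from word_eval_pres_eq[OF f R this] show ?thesis by (simp add: h_def)
  qed
  have "h \<in> hom (presented_group X R) G"
    by (rule homI)
      (auto simp: carrier_presented_group h pres_class_mult
         word_eval_append[OF f] word_eval_closed[OF f])
  then show ?thesis using h by blast
qed

end


section \<open>The Artin and Coxeter groups of type D\<close>

datatype D_gen = Sig nat | Rho

definition D_gens :: "nat \<Rightarrow> D_gen set" where
  "D_gens n = insert Rho (Sig ` {1..n - 1})"

definition D_braid_rels :: "nat \<Rightarrow> (D_gen word \<times> D_gen word) set" where
  "D_braid_rels n =
     {(gen (Sig i) @ gen (Sig j), gen (Sig j) @ gen (Sig i)) |i j.
        i \<in> {1..n - 1} \<and> j \<in> {1..n - 1} \<and> \<bar>int i - int j\<bar> > 1}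
   \<union> {(gen (Sig i) @ gen (Sig (i + 1)) @ gen (Sig i),
       gen (Sig (i + 1)) @ gen (Sig i) @ gen (Sig (i + 1))) |i. i \<in> {1..n - 2}}
   \<union> {(gen Rho @ gen (Sig i), gen (Sig i) @ gen Rho) |i. i \<in> {1..n - 1} \<and> i \<noteq> 2}
   \<union> {(gen Rho @ gen (Sig 2) @ gen Rho, gen (Sig 2) @ gen Rho @ gen (Sig 2))}"

definition D_coxeter_rels :: "nat \<Rightarrow> (D_gen word \<times> D_gen word) set" where
  "D_coxeter_rels n = D_braid_rels n \<union> {(wpow (gen x) 2, []) |x. x \<in> D_gens n}"

definition Br_D :: "nat \<Rightarrow> D_gen word set monoid" where
  "Br_D n = presented_group (D_gens n) (D_braid_rels n)"

definition Cox_D :: "nat \<Rightarrow> D_gen word set monoid" where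
  "Cox_D n = presented_group (D_gens n) (D_coxeter_rels n)"


section \<open>The presentation with three generators\<close>

datatype three_gen = G\<sigma>\<^sub>1 | G\<sigma> | G\<rho>

abbreviation (input) w\<sigma>\<^sub>1 :: "three_gen word" where "w\<sigma>\<^sub>1 \<equiv> gen G\<sigma>\<^sub>1"
abbreviation (input) w\<sigma> :: "three_gen word" where "w\<sigma> \<equiv> gen G\<sigma>"
abbreviation (input) w\<rho> :: "three_gen word" where "w\<rho> \<equiv> gen G\<rho>"

definition sigma_conj :: "nat \<Rightarrow> three_gen word" where
  "sigma_conj i = wpow w\<sigma> i @ w\<sigma>\<^sub>1 @ winv (wpow w\<sigma> i)"

definition three_braid_rels :: "nat \<Rightarrow> (three_gen word \<times> three_gen word) set" where
  "three_braid_rels n =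
     {(w\<sigma>\<^sub>1 @ sigma_conj i, sigma_conj i @ w\<sigma>\<^sub>1) |i. 2 \<le> i \<and> 2 * i \<le> n}
   \<union> {(wpow w\<sigma> n, wpow (w\<sigma> @ w\<sigma>\<^sub>1) (n - 1))}
   \<union> {(w\<rho> @ sigma_conj i, sigma_conj i @ w\<rho>) |i. i = 0 \<or> i \<in> {2..n - 2}}
   \<union> {(w\<rho> @ sigma_conj 1 @ w\<rho>, sigma_conj 1 @ w\<rho> @ sigma_conj 1)}"

definition three_coxeter_rels :: "nat \<Rightarrow> (three_gen word \<times> three_gen word) set" where
  "three_coxeter_rels n = three_braid_rels n \<union> {(wpow w\<sigma>\<^sub>1 2, []), (wpow w\<rho> 2, [])}"

text \<open>The three generators as words in the canonical generators.\<close>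

fun three_word :: "nat \<Rightarrow> three_gen \<Rightarrow> D_gen word" where
  "three_word n G\<sigma>\<^sub>1 = gen (Sig 1)"
| "three_word n G\<sigma> = concat (map (\<lambda>i. gen (Sig i)) [1..<n])"
| "three_word n G\<rho> = gen Rho"

end

theory Submission imports Defs begin

text \<open>Conjugation by \<open>\<sigma>\<close> shifts \<open>\<sigma>\<^sub>i\<close> to \<open>\<sigma>\<^sub>i\<^sub>+\<^sub>1\<close>, so \<open>\<sigma>\<^sub>i\<close> is recovered as
  \<open>a\<^sub>i = \<sigma>\<^sup>i\<^sup>-\<^sup>1 \<sigma>\<^sub>1 \<sigma>\<^sup>1\<^sup>-\<^sup>i\<close>. For arbitrary \<open>\<sigma>\<close> and \<open>\<sigma>\<^sub>1\<close> one has
  \<open>(\<sigma> \<sigma>\<^sub>1)\<^sup>n\<^sup>-\<^sup>1 = a\<^sub>2 \<dots> a\<^sub>n \<sigma>\<^sup>n\<^sup>-\<^sup>1\<close>, hence the relation \<open>\<sigma>\<^sup>n = (\<sigma> \<sigma>\<^sub>1)\<^sup>n\<^sup>-\<^sup>1\<close> just says that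
  \<open>\<sigma> = a\<^sub>1 \<dots> a\<^sub>n\<^sub>-\<^sub>1\<close>. It also makes \<open>\<sigma>\<^sup>n\<close> commute with \<open>\<sigma>\<^sub>1\<close>, so \<open>a\<^sub>i\<close> is periodic in \<open>i\<close> with period \<open>n\<close>
  and the commutations for \<open>2 \<le> i \<le> n/2\<close> imply those for \<open>2 \<le> i \<le> n - 2\<close>. Finally
  \<open>\<sigma> a\<^sub>1 = a\<^sub>2 \<sigma>\<close>, after cancelling the factors \<open>a\<^sub>3 \<dots> a\<^sub>n\<^sub>-\<^sub>1\<close> that commute with \<open>a\<^sub>1\<close>, is
  the braid relation.\<close>

section \<open>Presentations of a presented group\<close>

lemma wpow_0 [simp]: "wpow w 0 = []"
  by (simp add: wpow_def)

lemma wpow_Suc [simp]: "wpow w (Suc k) = w @ wpow w k"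
  by (simp add: wpow_def)

context group
begin

lemma word_eval_gen [simp]: "f x \<in> carrier G \<Longrightarrow> word_eval G f (gen x) = f x"
  by (simp add: gen_def)

lemma word_eval_winv:
  assumes f: "f \<in> X \<rightarrow> carrier G" and "w \<in> words X"
  shows "word_eval G f (winv w) = inv (word_eval G f w)"
  using assms(2)
proof (induction w)
  case (Cons a w)
  obtain x b where a: "a = (x, b)" by force
  have x: "x \<in> X" "f x \<in> carrier G" and w: "w \<in> words X"
    using Cons.prems a f by auto
  then show ?case
    using Cons.IH word_eval_closed[OF f w]
    by (simp add: a word_eval_append[OF f] inv_mult_group)
qed simp

lemma word_eval_wpow:
  assumes f: "f \<in> X \<rightarrow> carrier G" and w: "w \<in> words X"
  shows "word_eval G f (wpow w k) = word_eval G f w [^] k"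
proof (induction k)
  case (Suc k)
  then show ?case
    using w word_eval_closed[OF f w] nat_pow_Suc2[OF word_eval_closed[OF f w], of k]
    by (simp add: word_eval_append[OF f])
qed simp

lemma hom_word_eval:
  assumes H: "group H" and h: "h \<in> hom G H" and f: "f \<in> X \<rightarrow> carrier G"
    and "w \<in> words X"
  shows "h (word_eval G f w) = word_eval H (\<lambda>x. h (f x)) w"
  using assms(4)
proof (induction w)
  case Nil
  then show ?case
    using hom_one[OF h is_group H] by (simp add: group.word_eval_Nil[OF H])
next
  case (Cons a w)
  interpret h: group_hom G H h
    using H h by (simp add: group_hom_def group_hom_axioms_def is_group)
  obtain x b where a: "a = (x, b)" by force
  have "f x \<in> carrier G" and w: "w \<in> words X"
    using Cons.prems a f by auto
  then show ?case
    using Cons.IH word_eval_closed[OF f w]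
    by (simp add: a group.word_eval_Cons[OF H])
qed

lemma word_eval_cong:
  "(\<And>x. x \<in> X \<Longrightarrow> f x = g x) \<Longrightarrow> w \<in> words X \<Longrightarrow> word_eval G f w = word_eval G g w"
  by (induction w) auto

end

section \<open>Words evaluated in a presented group\<close>

lemma pres_class_closed: "w \<in> words X \<Longrightarrow> pres_class X R w \<in> carrier (presented_group X R)"
  by (simp add: carrier_presented_group)

text \<open>The bridge between relations among words and equations in the presented group. Only the
  letters marked \<open>False\<close> need an argument: their classes must be the inverses of the
  classes of generators.\<close>

lemma word_eval_presented_group:
  assumes "w \<in> words X"
  shows "word_eval (presented_group X R) (\<lambda>x. pres_class X R (gen x)) w = pres_class X R w"
  using assms
proof (induction w)
  case Nil
  then show ?case
    by (simp add: group.word_eval_Nil[OF group_presented_group] one_presented_group)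
next
  case (Cons a w)
  interpret P: group "presented_group X R" by (rule group_presented_group)
  obtain x b where a: "a = (x, b)" by force
  have x: "x \<in> X" and w: "w \<in> words X"
    using Cons.prems a by auto
  \<comment> \<open>In a group a left inverse is the inverse, so free cancellation on one side is
    enough.\<close>
  have "pres_eq X R ([(x, False)] @ gen x) []"
    using pres_eq.cancel[OF x, of R False] by (simp add: gen_def)
  then have "pres_class X R [(x, False)] \<otimes>\<^bsub>presented_group X R\<^esub> pres_class X R (gen x)
      = \<one>\<^bsub>presented_group X R\<^esub>"
    using x by (simp add: pres_class_mult pres_class_eq_iff one_presented_group)
  then have "inv\<^bsub>presented_group X R\<^esub> pres_class X R (gen x) = pres_class X R [(x, False)]"
    using x by (intro P.inv_equality) (auto intro: pres_class_closed)
  then show ?case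
    using Cons.IH[OF w] x w by (cases b) (simp_all add: a pres_class_mult, simp add: gen_def)
qed

lemma presented_group_rel:
  assumes "R \<subseteq> words X \<times> words X" "(u, v) \<in> R"
  shows "word_eval (presented_group X R) (\<lambda>x. pres_class X R (gen x)) u =
    word_eval (presented_group X R) (\<lambda>x. pres_class X R (gen x)) v"
proof -
  have "u \<in> words X" "v \<in> words X" using assms by auto
  then show ?thesis
    using assms(2) by (simp add: word_eval_presented_group pres_class_eq_iff pres_eq.rel)
qed

text \<open>The universal property gives a homomorphism in each direction, because \<open>fw\<close>
  and \<open>bw\<close> carry relations to valid equations. A homomorphism is determined by its
  values on generators, so \<open>bw_fw\<close> and \<open>fw_bw\<close> make the two maps mutually
  inverse.\<close>

theorem has_presentation_presented_groupI:
  fixes X :: "'x set" and Y :: "'y set" and R S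
  defines "P \<equiv> presented_group X R" and "Q \<equiv> presented_group Y S"
  assumes R: "R \<subseteq> words X \<times> words X"
    and fw: "\<And>x. x \<in> X \<Longrightarrow> fw x \<in> words Y"
    and bw: "\<And>y. y \<in> Y \<Longrightarrow> bw y \<in> words X"
    and fw_rel: "\<And>u v. (u, v) \<in> R \<Longrightarrow>
      word_eval Q (\<lambda>x. pres_class Y S (fw x)) u = word_eval Q (\<lambda>x. pres_class Y S (fw x)) v"
    and bw_rel: "\<And>u v. (u, v) \<in> S \<Longrightarrow>
      word_eval P (\<lambda>y. pres_class X R (bw y)) u = word_eval P (\<lambda>y. pres_class X R (bw y)) v"
    and bw_fw: "\<And>x. x \<in> X \<Longrightarrow>
      word_eval P (\<lambda>y. pres_class X R (bw y)) (fw x) = pres_class X R (gen x)"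
    and fw_bw: "\<And>y. y \<in> Y \<Longrightarrow>
      word_eval Q (\<lambda>x. pres_class Y S (fw x)) (bw y) = pres_class Y S (gen y)"
  shows "has_presentation Q X R (\<lambda>x. pres_class Y S (fw x))"
proof -
  interpret P: group P unfolding P_def by (rule group_presented_group)
  interpret Q: group Q unfolding Q_def by (rule group_presented_group)
  let ?f = "\<lambda>x. pres_class Y S (fw x)" and ?g = "\<lambda>y. pres_class X R (bw y)"
  have f: "?f \<in> X \<rightarrow> carrier Q" and g: "?g \<in> Y \<rightarrow> carrier P"
    using fw bw by (auto simp: P_def Q_def pres_class_closed)
  obtain \<phi> where \<phi>: "\<phi> \<in> hom P Q"
      "\<And>w. w \<in> words X \<Longrightarrow> \<phi> (pres_class X R w) = word_eval Q ?f w"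
    using Q.presented_group_universal[OF f, of R, folded P_def, OF fw_rel] by auto
  obtain \<psi> where \<psi>: "\<psi> \<in> hom Q P"
      "\<And>w. w \<in> words Y \<Longrightarrow> \<psi> (pres_class Y S w) = word_eval P ?g w"
    using P.presented_group_universal[OF g, of S, folded Q_def, OF bw_rel] by auto
  have "\<psi> (\<phi> (pres_class X R w)) = pres_class X R w" if w: "w \<in> words X" for w
  proof -
    have "\<psi> (\<phi> (pres_class X R w)) = word_eval P (\<lambda>x. \<psi> (?f x)) w"
      using \<phi>(2) w Q.hom_word_eval[OF P.is_group \<psi>(1) f w] by simp
    also have "\<dots> = word_eval P (\<lambda>x. pres_class X R (gen x)) w"
      using \<psi>(2) fw bw_fw by (intro P.word_eval_cong[OF _ w]) simp
    finally show ?thesis using w by (simp add: P_def word_eval_presented_group)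
  qed
  moreover have "\<phi> (\<psi> (pres_class Y S w)) = pres_class Y S w" if w: "w \<in> words Y" for w
  proof -
    have "\<phi> (\<psi> (pres_class Y S w)) = word_eval Q (\<lambda>y. \<phi> (?g y)) w"
      using \<psi>(2) w P.hom_word_eval[OF Q.is_group \<phi>(1) g w] by simp
    also have "\<dots> = word_eval Q (\<lambda>y. pres_class Y S (gen y)) w"
      using \<phi>(2) bw fw_bw by (intro Q.word_eval_cong[OF _ w]) simp
    finally show ?thesis using w by (simp add: Q_def word_eval_presented_group)
  qed
  ultimately have "bij_betw \<phi> (carrier P) (carrier Q)"
    using hom_carrier[OF \<phi>(1)] hom_carrier[OF \<psi>(1)]
    by (intro bij_betw_byWitness[where f' = \<psi>])
      (simp_all add: P_def Q_def carrier_presented_group)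
  then have "\<phi> \<in> iso P Q" using \<phi>(1) by (simp add: iso_def)
  moreover have "\<phi> (pres_class X R (gen x)) = ?f x" if "x \<in> X" for x
    using that f by (simp add: \<phi>(2) Pi_iff)
  ultimately show ?thesis
    unfolding has_presentation_def using R Q.is_group by (auto simp: P_def)
qed


section \<open>Conjugates by powers of an element\<close>

context group
begin

definition conjg :: "'a \<Rightarrow> 'a \<Rightarrow> 'a" where
  "conjg g x = g \<otimes> x \<otimes> inv g"

text \<open>The factors need not commute, so their order is fixed by the recursion; indices start at
  1 to match the canonical generators.\<close>

primrec gprod :: "(nat \<Rightarrow> 'a) \<Rightarrow> nat \<Rightarrow> 'a" where
  "gprod a 0 = \<one>"
| "gprod a (Suc m) = gprod a m \<otimes> a (Suc m)"

lemma inv_mult_cancel_left: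
  "\<lbrakk>g \<in> carrier G; x \<in> carrier G\<rbrakk> \<Longrightarrow> inv g \<otimes> (g \<otimes> x) = x"
  by (simp add: m_assoc[symmetric])

lemma conjg_closed [simp]:
  "\<lbrakk>g \<in> carrier G; x \<in> carrier G\<rbrakk> \<Longrightarrow> conjg g x \<in> carrier G"
  by (simp add: conjg_def)

lemma conjg_one [simp]: "x \<in> carrier G \<Longrightarrow> conjg \<one> x = x"
  by (simp add: conjg_def)

lemma conjg_of_one [simp]: "g \<in> carrier G \<Longrightarrow> conjg g \<one> = \<one>"
  by (simp add: conjg_def)

lemma conjg_self [simp]: "g \<in> carrier G \<Longrightarrow> conjg g g = g"
  by (simp add: conjg_def m_assoc)

lemma conjg_mult:
  "\<lbrakk>g \<in> carrier G; x \<in> carrier G; y \<in> carrier G\<rbrakk> \<Longrightarrow> conjg g (x \<otimes> y) = conjg g x \<otimes> conjg g y"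
  by (simp add: conjg_def m_assoc inv_mult_cancel_left)

lemma conjg_conjg:
  "\<lbrakk>g \<in> carrier G; h \<in> carrier G; x \<in> carrier G\<rbrakk> \<Longrightarrow> conjg g (conjg h x) = conjg (g \<otimes> h) x"
  by (simp add: conjg_def m_assoc inv_mult_group)

lemma conjg_eqI:
  "\<lbrakk>g \<otimes> x = y \<otimes> g; g \<in> carrier G; x \<in> carrier G; y \<in> carrier G\<rbrakk> \<Longrightarrow> conjg g x = y"
  by (simp add: conjg_def m_assoc)

lemma conjg_mult_self:
  "\<lbrakk>g \<in> carrier G; x \<in> carrier G\<rbrakk> \<Longrightarrow> conjg g x \<otimes> g = g \<otimes> x"
  by (simp add: conjg_def m_assoc)

lemma conjg_inject:
  "\<lbrakk>g \<in> carrier G; x \<in> carrier G; y \<in> carrier G\<rbrakk> \<Longrightarrow> conjg g x = conjg g y \<longleftrightarrow> x = y"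
  by (simp add: conjg_def)

lemma conjg_pow_pow:
  "\<lbrakk>s \<in> carrier G; x \<in> carrier G\<rbrakk>
    \<Longrightarrow> conjg (s [^] (i::nat)) (conjg (s [^] (j::nat)) x) = conjg (s [^] (i + j)) x"
  by (simp add: conjg_conjg nat_pow_mult)

lemma conjg_pow_Suc:
  "\<lbrakk>s \<in> carrier G; x \<in> carrier G\<rbrakk> \<Longrightarrow> conjg (s [^] Suc i) x = conjg s (conjg (s [^] i) x)"
  using conjg_pow_pow[of s x 1 i] by simp

section \<open>Ordered products and powers of \<open>s \<otimes> a\<close>\<close>

lemma gprod_closed:
  "(\<And>i. \<lbrakk>1 \<le> i; i \<le> m\<rbrakk> \<Longrightarrow> a i \<in> carrier G) \<Longrightarrow> gprod a m \<in> carrier G"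
  by (induction m) auto

lemma gprod_cong:
  "(\<And>i. \<lbrakk>1 \<le> i; i \<le> m\<rbrakk> \<Longrightarrow> a i = b i) \<Longrightarrow> gprod a m = gprod b m"
  by (induction m) auto

lemma gprod_Suc_left:
  "(\<And>i. \<lbrakk>1 \<le> i; i \<le> Suc m\<rbrakk> \<Longrightarrow> a i \<in> carrier G)
    \<Longrightarrow> gprod a (Suc m) = a 1 \<otimes> gprod (\<lambda>i. a (Suc i)) m"
proof (induction m)
  case (Suc m)
  have "gprod (\<lambda>i. a (Suc i)) m \<in> carrier G" "a 1 \<in> carrier G" "a (Suc (Suc m)) \<in> carrier G"
    using Suc.prems by (auto intro: gprod_closed)
  then show ?case
    using Suc by (simp add: m_assoc)
qed simp

lemma gprod_commute:
  assumes "x \<in> carrier G" "\<And>i. \<lbrakk>1 \<le> i; i \<le> m\<rbrakk> \<Longrightarrow> a i \<in> carrier G"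
    and "\<And>i. \<lbrakk>1 \<le> i; i \<le> m\<rbrakk> \<Longrightarrow> x \<otimes> a i = a i \<otimes> x"
  shows "x \<otimes> gprod a m = gprod a m \<otimes> x"
  using assms
proof (induction m)
  case (Suc m)
  have c: "gprod a m \<in> carrier G" "a (Suc m) \<in> carrier G" "x \<in> carrier G"
    using Suc.prems by (auto intro: gprod_closed)
  have "x \<otimes> gprod a (Suc m) = (x \<otimes> gprod a m) \<otimes> a (Suc m)"
    using c by (simp add: m_assoc)
  also have "\<dots> = gprod a m \<otimes> (x \<otimes> a (Suc m))"
    using Suc c by (simp add: m_assoc)
  also have "\<dots> = gprod a (Suc m) \<otimes> x"
    using Suc.prems c by (simp add: m_assoc)
  finally show ?case .
qed simp

lemma conjg_gprod:
  assumes "g \<in> carrier G" "\<And>i. \<lbrakk>1 \<le> i; i \<le> m\<rbrakk> \<Longrightarrow> a i \<in> carrier G"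
  shows "conjg g (gprod a m) = gprod (\<lambda>i. conjg g (a i)) m"
  using assms by (induction m) (simp_all add: conjg_mult gprod_closed)

text \<open>Collecting all copies of \<open>s\<close> at the right end conjugates the i-th
  \<open>a\<close> by the \<open>i\<close> copies of \<open>s\<close> on its left.\<close>

lemma pow_mult_eq_gprod:
  assumes "s \<in> carrier G" "a \<in> carrier G"
  shows "(s \<otimes> a) [^] m = gprod (\<lambda>i. conjg (s [^] i) a) m \<otimes> s [^] m"
proof (induction m)
  case (Suc m)
  let ?p = "gprod (\<lambda>i. conjg (s [^] i) a) m"
  have p: "?p \<in> carrier G" using assms by (auto intro: gprod_closed)
  have "(s \<otimes> a) [^] Suc m = ?p \<otimes> (s [^] Suc m \<otimes> a)"
    using Suc p assms by (simp add: m_assoc)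
  also have "\<dots> = ?p \<otimes> (conjg (s [^] Suc m) a \<otimes> s [^] Suc m)"
    using assms by (simp only: conjg_mult_self nat_pow_closed)
  finally show ?case using p assms by (simp add: m_assoc)
qed simp

text \<open>Cancelling the (n-1)-st power of \<open>s\<close> in the expansion of
  \<open>(s \<otimes> a) [^] (n - 1)\<close> leaves \<open>s\<close> equal to a product of
  conjugates with exponents 1 to n-1. Conjugation by \<open>s\<close> is injective, fixes
  \<open>s\<close> and raises each exponent by one, so the exponents may be lowered to 0 to
  n-2.\<close>

lemma pow_eq_iff_gprod:
  assumes s: "s \<in> carrier G" and a: "a \<in> carrier G" and n: "0 < n"
  shows "s [^] n = (s \<otimes> a) [^] (n - 1) \<longleftrightarrow> gprod (\<lambda>i. conjg (s [^] (i - 1)) a) (n - 1) = s"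
proof -
  let ?p = "gprod (\<lambda>i. conjg (s [^] i) a) (n - 1)"
  let ?q = "gprod (\<lambda>i. conjg (s [^] (i - 1)) a) (n - 1)"
  have c: "?p \<in> carrier G" "?q \<in> carrier G" using s a by (auto intro: gprod_closed)
  have "conjg s ?q = gprod (\<lambda>i. conjg s (conjg (s [^] (i - 1)) a)) (n - 1)"
    using s a by (simp add: conjg_gprod)
  also have "\<dots> = ?p"
    using s a by (intro gprod_cong) (simp add: conjg_pow_Suc[symmetric] del: nat_pow_Suc)
  finally have q: "conjg s ?q = ?p" .
  have "s [^] n = s \<otimes> s [^] (n - 1)"
    using n s nat_pow_Suc2[of s "n - 1"] by simp
  then have "s [^] n = (s \<otimes> a) [^] (n - 1) \<longleftrightarrow> s = ?p"
    using c s by (simp add: pow_mult_eq_gprod[OF s a])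
  also have "\<dots> \<longleftrightarrow> conjg s s = conjg s ?q" using q s by simp
  also have "\<dots> \<longleftrightarrow> ?q = s" using conjg_inject[OF s s c(2)] by auto
  finally show ?thesis .
qed


section \<open>The two-generator form of the braid relations\<close>

text \<open>Induction on \<open>m\<close>: a new last factor far from \<open>s i\<close> commutes
  with it, and the only other case, \<open>i = m\<close>, is where the braid relation
  enters.\<close>

lemma gprod_shift:
  assumes s: "\<And>i. \<lbrakk>1 \<le> i; i < n\<rbrakk> \<Longrightarrow> s i \<in> carrier G"
    and comm: "\<And>i j. \<lbrakk>1 \<le> i; i + 2 \<le> j; j < n\<rbrakk> \<Longrightarrow> s i \<otimes> s j = s j \<otimes> s i"
    and braid: "\<And>i. \<lbrakk>1 \<le> i; i + 1 < n\<rbrakk> \<Longrightarrow>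
      s i \<otimes> (s (i + 1) \<otimes> s i) = s (i + 1) \<otimes> (s i \<otimes> s (i + 1))"
    and "m < n" "1 \<le> i" "i < m"
  shows "gprod s m \<otimes> s i = s (i + 1) \<otimes> gprod s m"
  using assms(4-6)
proof (induction m)
  case (Suc m)
  have p: "gprod s m \<in> carrier G" and c: "s (Suc m) \<in> carrier G" "s i \<in> carrier G"
    "s (Suc i) \<in> carrier G"
    using Suc.prems s by (auto intro: gprod_closed)
  show ?case
  proof (cases "i < m")
    case True
    have "gprod s (Suc m) \<otimes> s i = gprod s m \<otimes> (s i \<otimes> s (Suc m))"
      using True Suc.prems p c comm[of i "Suc m"] by (simp add: m_assoc)
    also have "\<dots> = (gprod s m \<otimes> s i) \<otimes> s (Suc m)"
      using p c by (simp add: m_assoc)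
    also have "\<dots> = s (i + 1) \<otimes> gprod s (Suc m)"
      using True Suc p c by (simp add: m_assoc)
    finally show ?thesis .
  next
    case False
    then have i: "i = m" using Suc.prems by simp
    then obtain k where k: "m = Suc k" using Suc.prems by (cases m) auto
    let ?q = "gprod s k"
    have q: "?q \<in> carrier G" using Suc.prems k s by (auto intro!: gprod_closed)
    \<comment> \<open>With the factor \<open>s m\<close> split off, the indices left in
      \<open>?q\<close> are at most \<open>m - 1\<close>, hence at distance at least 2 from
      \<open>Suc m\<close>.\<close>
    have cq: "s (Suc m) \<otimes> ?q = ?q \<otimes> s (Suc m)"
    proof (rule gprod_commute)
      fix j assume j: "1 \<le> j" "j \<le> k"
      then show "s j \<in> carrier G" using s[of j] Suc.prems k by simp
      show "s (Suc m) \<otimes> s j = s j \<otimes> s (Suc m)"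
        using comm[of j "Suc m"] j Suc.prems k by simp
    qed (use c in simp)
    have "gprod s (Suc m) \<otimes> s i = ?q \<otimes> (s m \<otimes> (s (Suc m) \<otimes> s m))"
      using q c i by (simp add: k m_assoc)
    also have "\<dots> = ?q \<otimes> (s (Suc m) \<otimes> (s m \<otimes> s (Suc m)))"
      using braid[of m] Suc.prems i by simp
    also have "\<dots> = (s (Suc m) \<otimes> ?q) \<otimes> (s m \<otimes> s (Suc m))"
      using q c i cq by (simp add: m_assoc)
    also have "\<dots> = s (i + 1) \<otimes> gprod s (Suc m)"
      using q c i by (simp add: k m_assoc)
    finally show ?thesis .
  qed
qed simp

text \<open>Iterates \<open>gprod_shift\<close> for the full product: each conjugation raises the
  index by one, starting from \<open>s 1\<close>.\<close>

lemma conjg_pow_gprod: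
  assumes s: "\<And>i. \<lbrakk>1 \<le> i; i < n\<rbrakk> \<Longrightarrow> s i \<in> carrier G"
    and comm: "\<And>i j. \<lbrakk>1 \<le> i; i + 2 \<le> j; j < n\<rbrakk> \<Longrightarrow> s i \<otimes> s j = s j \<otimes> s i"
    and braid: "\<And>i. \<lbrakk>1 \<le> i; i + 1 < n\<rbrakk> \<Longrightarrow>
      s i \<otimes> (s (i + 1) \<otimes> s i) = s (i + 1) \<otimes> (s i \<otimes> s (i + 1))"
    and "i + 1 < n"
  shows "conjg (gprod s (n - 1) [^] i) (s 1) = s (i + 1)"
  using assms(4)
proof (induction i)
  case 0
  then show ?case using s[of 1] by simp
next
  case (Suc i)
  have p: "gprod s (n - 1) \<in> carrier G" using s by (auto intro: gprod_closed)
  have c: "s 1 \<in> carrier G" "s (i + 1) \<in> carrier G" "s (i + 2) \<in> carrier G"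
    using s Suc.prems by auto
  have "conjg (gprod s (n - 1) [^] Suc i) (s 1) = conjg (gprod s (n - 1)) (s (i + 1))"
    using Suc.IH Suc.prems p c conjg_pow_Suc[of "gprod s (n - 1)" "s 1" i] by simp
  also have "\<dots> = s (i + 2)"
    using gprod_shift[of n s, OF s comm braid, of "n - 1" "i + 1"] Suc.prems p c
    by (intro conjg_eqI) auto
  finally show ?case by simp
qed

text \<open>For \<open>i\<close> above n/2, the known commutation for the complementary exponent
  \<open>n - i\<close> is conjugated by \<open>s [^] i\<close>; the exponent becomes
  \<open>n\<close>, where conjugation fixes \<open>a\<close>.\<close>

lemma conjg_pow_commute:
  fixes n i :: nat
  assumes s: "s \<in> carrier G" and a: "a \<in> carrier G"
    and pow: "s [^] n = (s \<otimes> a) [^] (n - 1)"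
    and comm: "\<And>i. \<lbrakk>2 \<le> i; 2 * i \<le> n\<rbrakk> \<Longrightarrow> a \<otimes> conjg (s [^] i) a = conjg (s [^] i) a \<otimes> a"
    and i: "2 \<le> i" "i + 2 \<le> n"
  shows "a \<otimes> conjg (s [^] i) a = conjg (s [^] i) a \<otimes> a"
proof (cases "2 * i \<le> n")
  case True
  then show ?thesis using comm i by simp
next
  case False
  define j where "j = n - i"
  have j: "2 \<le> j" "2 * j \<le> n" "i + j = n" using False i by (auto simp: j_def)
  let ?z = "s [^] n"
  have z: "?z \<in> carrier G" using s by simp
  \<comment> \<open>By \<open>pow\<close>, \<open>?z\<close> is also a power of
    \<open>s \<otimes> a\<close>. Commuting with both \<open>s \<otimes> a\<close> and
    \<open>s\<close>, it commutes with \<open>a\<close>.\<close>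
  have "?z \<otimes> (s \<otimes> a) = (s \<otimes> a) \<otimes> ?z"
    using s a nat_pow_Suc2[of "s \<otimes> a" "n - 1"] unfolding pow by simp
  moreover have "?z \<otimes> s = s \<otimes> ?z"
    using s nat_pow_Suc2[of s n] by simp
  ultimately have "s \<otimes> (?z \<otimes> a) = s \<otimes> (a \<otimes> ?z)"
    using s a z by (metis m_assoc)
  then have "?z \<otimes> a = a \<otimes> ?z" using s a z by simp
  then have per: "conjg ?z a = a" using a z by (intro conjg_eqI)
  have "conjg (s [^] i) (a \<otimes> conjg (s [^] j) a) = conjg (s [^] i) (conjg (s [^] j) a \<otimes> a)"
    using comm[OF j(1,2)] by simp
  then show ?thesis
    using s a j(3) per by (simp add: conjg_mult conjg_pow_pow)
qed

lemma conjg_braid: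
  assumes s: "s \<in> carrier G" and a: "a \<in> carrier G" and n: "3 \<le> n"
    and prod: "gprod (\<lambda>i. conjg (s [^] (i - 1)) a) (n - 1) = s"
    and comm: "\<And>i. \<lbrakk>2 \<le> i; i + 2 \<le> n\<rbrakk> \<Longrightarrow> a \<otimes> conjg (s [^] i) a = conjg (s [^] i) a \<otimes> a"
  shows "a \<otimes> (conjg s a \<otimes> a) = conjg s a \<otimes> (a \<otimes> conjg s a)"
proof -
  let ?b = "conjg s a"
  \<comment> \<open>The factors of \<open>s\<close> after the first two. Their exponents run from 2
    to n-2, exactly the range of \<open>comm\<close>; for n = 3 the product is empty.\<close>
  let ?q = "gprod (\<lambda>i. conjg (s [^] (i + 1)) a) (n - 3)"
  obtain m where m: "n = m + 3" using n by (metis add.commute le_Suc_ex)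
  have q: "?q \<in> carrier G" using s a by (auto intro: gprod_closed)
  have eq: "a \<otimes> (?b \<otimes> ?q) = s"
    using prod s a by (simp add: m gprod_Suc_left numeral_3_eq_3 del: gprod.simps nat_pow_Suc)
  have cq: "a \<otimes> ?q = ?q \<otimes> a"
    using s a by (intro gprod_commute comm) auto
  have "s \<otimes> a = ?b \<otimes> s" using s a by (simp add: conjg_mult_self)
  \<comment> \<open>Writing \<open>s\<close> as \<open>a \<otimes> (?b \<otimes> ?q)\<close> on both
    sides puts \<open>?q\<close> at the right end once it is moved past \<open>a\<close>; cancelling
    it leaves the braid relation.\<close>
  then have "(a \<otimes> (?b \<otimes> ?q)) \<otimes> a = ?b \<otimes> (a \<otimes> (?b \<otimes> ?q))" by (simp only: eq)
  then have "(a \<otimes> (?b \<otimes> a)) \<otimes> ?q = (?b \<otimes> (a \<otimes> ?b)) \<otimes> ?q"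
    using s a q cq by (simp add: m_assoc)
  then show ?thesis using s a q by simp
qed


end


section \<open>Translating the relations\<close>

lemma three_word_closed: "3 \<le> n \<Longrightarrow> three_word n x \<in> words (D_gens n)"
  by (cases x) (auto simp: words_def gen_def D_gens_def)

text \<open>The substitution inverse to \<open>three_word\<close>. The exponent is
  \<open>i - 1\<close> because \<open>Sig 1\<close> is itself one of the three generators;
  truncation would matter only for \<open>Sig 0\<close>, which is not in
  \<open>D_gens n\<close>.\<close>

definition D_gen_word :: "D_gen \<Rightarrow> three_gen word" where
  "D_gen_word y = (case y of Sig i \<Rightarrow> sigma_conj (i - 1) | Rho \<Rightarrow> gen G\<rho>)"

context group
begin

lemma word_eval_sigma_conj:
  assumes "g \<in> UNIV \<rightarrow> carrier G"
  shows "word_eval G g (sigma_conj i) = conjg (g G\<sigma> [^] i) (g G\<sigma>\<^sub>1)"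
proof -
  have U: "words UNIV = UNIV" by (simp add: words_def)
  show ?thesis
    using assms unfolding sigma_conj_def conjg_def
    by (simp add: word_eval_append[OF assms] word_eval_winv[OF assms] word_eval_wpow[OF assms] U
        m_assoc Pi_iff)
qed

lemma word_eval_Sig_prod:
  assumes f: "f \<in> D_gens n \<rightarrow> carrier G" and "m < n"
  shows "word_eval G f (concat (map (\<lambda>i. gen (Sig i)) [1..<Suc m])) = gprod (\<lambda>i. f (Sig i)) m"
  using assms(2)
proof (induction m)
  case (Suc m)
  have w: "concat (map (\<lambda>i. gen (Sig i)) [1..<Suc m]) \<in> words (D_gens n)"
    using Suc.prems by (auto simp: words_def gen_def D_gens_def)
  have x: "Sig (Suc m) \<in> D_gens n" using Suc.prems by (auto simp: D_gens_def)
  have "[1..<Suc (Suc m)] = [1..<Suc m] @ [Suc m]" by simp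
  then show ?case
    using Suc f w x by (simp add: word_eval_append[OF f] Pi_iff del: upt_Suc)
qed simp

text \<open>Replaces statements about pairs of words by equations in an arbitrary group. The far
  commutations are symmetric in \<open>i\<close> and \<open>j\<close>, so the condition on the
  absolute value reduces to \<open>i + 2 \<le> j\<close>.\<close>

lemma D_braid_rels_sat_iff:
  assumes n: "3 \<le> n" and f: "f \<in> D_gens n \<rightarrow> carrier G"
  shows "(\<forall>(u, v) \<in> D_braid_rels n. word_eval G f u = word_eval G f v) \<longleftrightarrow>
    (\<forall>i j. 1 \<le> i \<longrightarrow> i + 2 \<le> j \<longrightarrow> j < n \<longrightarrow> f (Sig i) \<otimes> f (Sig j) = f (Sig j) \<otimes> f (Sig i)) \<and>
    (\<forall>i. 1 \<le> i \<longrightarrow> i + 1 < n \<longrightarrow> f (Sig i) \<otimes> (f (Sig (i + 1)) \<otimes> f (Sig i)) =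
      f (Sig (i + 1)) \<otimes> (f (Sig i) \<otimes> f (Sig (i + 1)))) \<and>
    (\<forall>i. 1 \<le> i \<longrightarrow> i < n \<longrightarrow> i \<noteq> 2 \<longrightarrow> f Rho \<otimes> f (Sig i) = f (Sig i) \<otimes> f Rho) \<and>
    f Rho \<otimes> (f (Sig 2) \<otimes> f Rho) = f (Sig 2) \<otimes> (f Rho \<otimes> f (Sig 2))"
    (is "_ \<longleftrightarrow> ?comm \<and> ?braid \<and> ?rho \<and> ?rho2")
proof -
  have g: "Rho \<in> D_gens n" "\<And>i. Sig i \<in> D_gens n \<longleftrightarrow> 1 \<le> i \<and> i < n"
    using n by (auto simp: D_gens_def)
  have c: "f Rho \<in> carrier G" "\<And>i. \<lbrakk>1 \<le> i; i < n\<rbrakk> \<Longrightarrow> f (Sig i) \<in> carrier G"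
    using f g by (auto simp: Pi_iff)
  have comm: "?comm \<longleftrightarrow> (\<forall>i j. i \<in> {1..n - 1} \<longrightarrow> j \<in> {1..n - 1} \<longrightarrow> \<bar>int i - int j\<bar> > 1 \<longrightarrow>
      f (Sig i) \<otimes> f (Sig j) = f (Sig j) \<otimes> f (Sig i))" (is "_ \<longleftrightarrow> ?C")
  proof
    assume C: ?comm
    show ?C
    proof (intro allI impI)
      fix i j assume ij: "i \<in> {1..n - 1}" "j \<in> {1..n - 1}" "\<bar>int i - int j\<bar> > 1"
      then consider "i + 2 \<le> j" | "j + 2 \<le> i" by linarith
      then show "f (Sig i) \<otimes> f (Sig j) = f (Sig j) \<otimes> f (Sig i)"
        using C[rule_format, of i j] C[rule_format, of j i] ij n by cases auto
    qed
  next
    assume ?C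
    then show ?comm by fastforce
  qed
  have "(\<forall>(u, v) \<in> D_braid_rels n. word_eval G f u = word_eval G f v) \<longleftrightarrow>
    ?C \<and>
    (\<forall>i. i \<in> {1..n - 2} \<longrightarrow> f (Sig i) \<otimes> (f (Sig (i + 1)) \<otimes> f (Sig i)) =
      f (Sig (i + 1)) \<otimes> (f (Sig i) \<otimes> f (Sig (i + 1)))) \<and>
    (\<forall>i. i \<in> {1..n - 1} \<longrightarrow> i \<noteq> 2 \<longrightarrow> f Rho \<otimes> f (Sig i) = f (Sig i) \<otimes> f Rho) \<and> ?rho2"
  proof -
    \<comment> \<open>Each family of relations is an indexed set, so quantifying over its members
      becomes quantifying over its indices.\<close>
    have b: "(\<forall>(u, v) \<in> {(U i, V i) |i. P i}. word_eval G f u = word_eval G f v) \<longleftrightarrow>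
        (\<forall>i. P i \<longrightarrow> word_eval G f (U i) = word_eval G f (V i))" for U V and P :: "nat \<Rightarrow> bool"
      by blast
    have b2: "(\<forall>(u, v) \<in> {(U i j, V i j) |i j. P i j}. word_eval G f u = word_eval G f v) \<longleftrightarrow>
        (\<forall>i j. P i j \<longrightarrow> word_eval G f (U i j) = word_eval G f (V i j))"
      for U V and P :: "nat \<Rightarrow> nat \<Rightarrow> bool"
      by blast
    have c': "f (Sig i) \<in> carrier G" "Sig i \<in> D_gens n" if "i \<in> {1..n - 1}" for i
      using that n c g by auto
    have "word_eval G f (gen (Sig i) @ gen (Sig j)) = f (Sig i) \<otimes> f (Sig j)"
      if "i \<in> {1..n - 1}" "j \<in> {1..n - 1}" for i j
      using c'[OF that(1)] c'[OF that(2)] by (simp add: word_eval_append[OF f])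
    moreover have "word_eval G f (gen (Sig i) @ gen (Sig j) @ gen (Sig k)) =
        f (Sig i) \<otimes> (f (Sig j) \<otimes> f (Sig k))"
      if "i \<in> {1..n - 1}" "j \<in> {1..n - 1}" "k \<in> {1..n - 1}" for i j k
      using c'[OF that(1)] c'[OF that(2)] c'[OF that(3)] by (simp add: word_eval_append[OF f])
    moreover have "i \<in> {1..n - 1}" "i + 1 \<in> {1..n - 1}" if "i \<in> {1..n - 2}" for i
      using that n by auto
    moreover have "word_eval G f (gen Rho @ gen (Sig i)) = f Rho \<otimes> f (Sig i)"
      "word_eval G f (gen (Sig i) @ gen Rho) = f (Sig i) \<otimes> f Rho"
      if "i \<in> {1..n - 1}" for i
      using c'[OF that] c(1) g(1) by (simp_all add: word_eval_append[OF f])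
    moreover have "word_eval G f (gen Rho @ gen (Sig 2) @ gen Rho) = f Rho \<otimes> (f (Sig 2) \<otimes> f Rho)"
      "word_eval G f (gen (Sig 2) @ gen Rho @ gen (Sig 2)) = f (Sig 2) \<otimes> (f Rho \<otimes> f (Sig 2))"
      using n c g by (auto simp: word_eval_append[OF f])
    ultimately show ?thesis
      unfolding D_braid_rels_def ball_Un b b2
      by (simp del: atLeastAtMost_iff add: imp_conjL conj_assoc cong: imp_cong)
  qed
  also have "\<dots> \<longleftrightarrow> ?C \<and> ?braid \<and> ?rho \<and> ?rho2"
  proof -
    have "i \<in> {1..n - 2} \<longleftrightarrow> 1 \<le> i \<and> i + 1 < n" "i \<in> {1..n - 1} \<longleftrightarrow> 1 \<le> i \<and> i < n" for i
      using n by auto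
    then show ?thesis by (simp only: imp_conjL)
  qed
  finally show ?thesis unfolding comm .
qed

lemma three_braid_rels_sat_iff:
  assumes g: "g \<in> UNIV \<rightarrow> carrier G"
  shows "(\<forall>(u, v) \<in> three_braid_rels n. word_eval G g u = word_eval G g v) \<longleftrightarrow>
    (\<forall>i. 2 \<le> i \<longrightarrow> 2 * i \<le> n \<longrightarrow> g G\<sigma>\<^sub>1 \<otimes> conjg (g G\<sigma> [^] i) (g G\<sigma>\<^sub>1) =
      conjg (g G\<sigma> [^] i) (g G\<sigma>\<^sub>1) \<otimes> g G\<sigma>\<^sub>1) \<and>
    g G\<sigma> [^] n = (g G\<sigma> \<otimes> g G\<sigma>\<^sub>1) [^] (n - 1) \<and>
    (\<forall>i. i = 0 \<or> i \<in> {2..n - 2} \<longrightarrow> g G\<rho> \<otimes> conjg (g G\<sigma> [^] i) (g G\<sigma>\<^sub>1) =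
      conjg (g G\<sigma> [^] i) (g G\<sigma>\<^sub>1) \<otimes> g G\<rho>) \<and>
    g G\<rho> \<otimes> (conjg (g G\<sigma>) (g G\<sigma>\<^sub>1) \<otimes> g G\<rho>) =
      conjg (g G\<sigma>) (g G\<sigma>\<^sub>1) \<otimes> (g G\<rho> \<otimes> conjg (g G\<sigma>) (g G\<sigma>\<^sub>1))"
proof -
  have b: "(\<forall>(u, v) \<in> {(U i, V i) |i. P i}. word_eval G g u = word_eval G g v) \<longleftrightarrow>
      (\<forall>i. P i \<longrightarrow> word_eval G g (U i) = word_eval G g (V i))" for U V and P :: "nat \<Rightarrow> bool"
    by blast
  have U: "words UNIV = UNIV" by (simp add: words_def)
  have c: "g x \<in> carrier G" for x using g by auto
  show ?thesis
    unfolding three_braid_rels_def ball_Un b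
    by (simp add: word_eval_append[OF g] word_eval_wpow[OF g] U word_eval_sigma_conj[OF g] c
        del: One_nat_def) (auto simp: c)
qed

text \<open>Stated for an arbitrary group satisfying the braid relations, so that it serves both the
  Artin and the Coxeter group. The second part says that rewriting a canonical generator in the
  three generators and substituting back changes nothing.\<close>

lemma three_braid_rels_if_D_braid_rels:
  assumes n: "3 \<le> n" and f: "f \<in> D_gens n \<rightarrow> carrier G"
    and rels: "\<forall>(u, v) \<in> D_braid_rels n. word_eval G f u = word_eval G f v"
  defines "g \<equiv> \<lambda>x. word_eval G f (three_word n x)"
  shows "\<forall>(u, v) \<in> three_braid_rels n. word_eval G g u = word_eval G g v"
    and "y \<in> D_gens n \<Longrightarrow> word_eval G g (D_gen_word y) = f y"
proof -
  define s where "s i = f (Sig i)" for i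
  have g: "g \<in> UNIV \<rightarrow> carrier G"
    using word_eval_closed[OF f three_word_closed[OF n]] by (auto simp: g_def)
  have s: "s i \<in> carrier G" if "1 \<le> i" "i < n" for i
    using that f by (auto simp: s_def D_gens_def Pi_iff)
  have r: "f Rho \<in> carrier G" using f by (auto simp: D_gens_def)
  \<comment> \<open>In order: far commutations, braid relations among the \<open>s i\<close>,
    commutations with the image of \<open>Rho\<close>, and its braid relation with
    \<open>s 2\<close>.\<close>
  note D = rels[unfolded D_braid_rels_sat_iff[OF n f] s_def[symmetric], THEN conjunct1, rule_format]
    rels[unfolded D_braid_rels_sat_iff[OF n f] s_def[symmetric], THEN conjunct2, THEN conjunct1,
      rule_format]
    rels[unfolded D_braid_rels_sat_iff[OF n f] s_def[symmetric], THEN conjunct2, THEN conjunct2,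
      THEN conjunct1, rule_format]
    rels[unfolded D_braid_rels_sat_iff[OF n f] s_def[symmetric], THEN conjunct2, THEN conjunct2,
      THEN conjunct2]
  have g1: "g G\<sigma>\<^sub>1 = s 1" and g3: "g G\<rho> = f Rho"
    using s[of 1] r n by (auto simp: g_def s_def)
  have g2: "g G\<sigma> = gprod s (n - 1)"
    using word_eval_Sig_prod[OF f, of "n - 1"] n by (simp add: g_def s_def[abs_def])
  have conj: "conjg (g G\<sigma> [^] i) (g G\<sigma>\<^sub>1) = s (i + 1)" if "i + 1 < n" for i
    using conjg_pow_gprod[of n s, OF s D(1,2) that] by (simp add: g1 g2)
  \<comment> \<open>The conjugates are the \<open>s i\<close> themselves, so this is the definition
    of \<sigma> as a product; \<open>pow_eq_iff_gprod\<close> turns it into the power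
    relation.\<close>
  have "gprod (\<lambda>i. conjg (g G\<sigma> [^] (i - 1)) (g G\<sigma>\<^sub>1)) (n - 1) = g G\<sigma>"
    unfolding g2 using n conj by (intro gprod_cong) (simp add: g2)
  then have pow: "g G\<sigma> [^] n = (g G\<sigma> \<otimes> g G\<sigma>\<^sub>1) [^] (n - 1)"
    using pow_eq_iff_gprod[of "g G\<sigma>" "g G\<sigma>\<^sub>1" n] g n by (auto simp: Pi_iff)
  have c1: "conjg (g G\<sigma>) (g G\<sigma>\<^sub>1) = s 2"
    using conj[of 1] g n by (simp add: Pi_iff numeral_2_eq_2)
  show "\<forall>(u, v) \<in> three_braid_rels n. word_eval G g u = word_eval G g v"
    unfolding three_braid_rels_sat_iff[OF g]
  proof (intro conjI allI impI)
    fix i assume "2 \<le> i" "2 * i \<le> n"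
    then show "g G\<sigma>\<^sub>1 \<otimes> conjg (g G\<sigma> [^] i) (g G\<sigma>\<^sub>1) = conjg (g G\<sigma> [^] i) (g G\<sigma>\<^sub>1) \<otimes> g G\<sigma>\<^sub>1"
      using conj[of i] D(1)[of 1 "i + 1"] n by (simp add: g1)
  next
    fix i assume "i = 0 \<or> i \<in> {2..n - 2}"
    \<comment> \<open>The missing exponent 1 corresponds to \<open>s 2\<close>, the one generator
      satisfying a braid relation with \<open>Rho\<close> instead.\<close>
    then have "i + 1 < n" "i + 1 \<noteq> 2" using n by auto
    then show "g G\<rho> \<otimes> conjg (g G\<sigma> [^] i) (g G\<sigma>\<^sub>1) = conjg (g G\<sigma> [^] i) (g G\<sigma>\<^sub>1) \<otimes> g G\<rho>"
      using D(3)[of "i + 1"] by (simp add: conj g3)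
  qed (use pow D(4) in \<open>simp_all add: c1 g3\<close>)
  show "word_eval G g (D_gen_word y) = f y" if "y \<in> D_gens n"
  proof (cases y)
    case (Sig i)
    then have "1 \<le> i" "i < n" using that by (auto simp: D_gens_def)
    then show ?thesis
      using conj[of "i - 1"] by (simp add: Sig D_gen_word_def word_eval_sigma_conj[OF g] s_def)
  next
    case Rho
    then show ?thesis using r g3 by (simp add: D_gen_word_def)
  qed
qed

text \<open>Every relation among the \<sigma>'s is a conjugate, by a power of \<open>s\<close>, of
  one that involves \<open>a\<close> itself; those come from \<open>conjg_pow_commute\<close> and
  \<open>conjg_braid\<close>.\<close>

lemma D_braid_rels_if_three_braid_rels:
  assumes n: "3 \<le> n" and g: "g \<in> UNIV \<rightarrow> carrier G"
    and rels: "\<forall>(u, v) \<in> three_braid_rels n. word_eval G g u = word_eval G g v"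
  defines "f \<equiv> \<lambda>y. word_eval G g (D_gen_word y)"
  shows "\<forall>(u, v) \<in> D_braid_rels n. word_eval G f u = word_eval G f v"
    and "word_eval G f (three_word n x) = g x"
proof -
  define s a r where "s = g G\<sigma>" and "a = g G\<sigma>\<^sub>1" and "r = g G\<rho>"
  have c: "s \<in> carrier G" "a \<in> carrier G" "r \<in> carrier G"
    using g by (auto simp: s_def a_def r_def)
  have f_Sig: "f (Sig i) = conjg (s [^] (i - 1)) a" for i
    by (simp add: f_def D_gen_word_def word_eval_sigma_conj[OF g] s_def a_def)
  have f_Rho: "f Rho = r"
    using c by (simp add: f_def D_gen_word_def r_def)
  have f: "f \<in> D_gens n \<rightarrow> carrier G"
    using c by (auto simp: D_gens_def f_Sig f_Rho)
  note T = rels[unfolded three_braid_rels_sat_iff[OF g], folded s_def a_def r_def]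
  have pow: "s [^] n = (s \<otimes> a) [^] (n - 1)" using T by blast
  then have prod: "gprod (\<lambda>i. conjg (s [^] (i - 1)) a) (n - 1) = s"
    using pow_eq_iff_gprod[of s a n] c n by auto
  have comm: "a \<otimes> conjg (s [^] i) a = conjg (s [^] i) a \<otimes> a" if "2 \<le> i" "i + 2 \<le> n" for i
    using conjg_pow_commute[OF c(1,2) pow _ that] T by blast
  have braid: "a \<otimes> (conjg s a \<otimes> a) = conjg s a \<otimes> (a \<otimes> conjg s a)"
    using conjg_braid[OF c(1,2) n prod comm] .
  show "\<forall>(u, v) \<in> D_braid_rels n. word_eval G f u = word_eval G f v"
    unfolding D_braid_rels_sat_iff[OF n f] f_Sig f_Rho
  proof (intro conjI allI impI)
    fix i j assume ij: "1 \<le> i" "i + 2 \<le> j" "j < n"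
    \<comment> \<open>Only the difference \<open>j - i\<close> matters, and it lies between 2 and
      n-2, where \<open>comm\<close> applies.\<close>
    then have "conjg (s [^] (i - 1)) (a \<otimes> conjg (s [^] (j - i)) a) =
        conjg (s [^] (i - 1)) (conjg (s [^] (j - i)) a \<otimes> a)"
      using comm[of "j - i"] by simp
    then show "conjg (s [^] (i - 1)) a \<otimes> conjg (s [^] (j - 1)) a =
        conjg (s [^] (j - 1)) a \<otimes> conjg (s [^] (i - 1)) a"
      using ij c by (simp add: conjg_mult conjg_pow_pow)
  next
    fix i assume i: "1 \<le> i" "i + 1 < n"
    \<comment> \<open>Conjugation by \<open>s [^] (i - 1)\<close> carries the pair \<open>a\<close>,
      \<open>conjg s a\<close> to the i-th and (i+1)-st generators, and so carries
      \<open>braid\<close> to their braid relation.\<close>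
    have e: "conjg (s [^] (i - 1)) (conjg s a) = conjg (s [^] i) a"
      using conjg_pow_pow[of s a "i - 1" 1] i c by simp
    have "conjg (s [^] (i - 1)) (a \<otimes> (conjg s a \<otimes> a)) =
        conjg (s [^] (i - 1)) (conjg s a \<otimes> (a \<otimes> conjg s a))"
      using braid by simp
    then show "conjg (s [^] (i - 1)) a \<otimes> (conjg (s [^] (i + 1 - 1)) a \<otimes> conjg (s [^] (i - 1)) a) =
        conjg (s [^] (i + 1 - 1)) a \<otimes> (conjg (s [^] (i - 1)) a \<otimes> conjg (s [^] (i + 1 - 1)) a)"
      using c by (simp add: conjg_mult e[symmetric])
  next
    fix i assume "1 \<le> i" "i < n" "i \<noteq> (2::nat)"
    then have "i - 1 = 0 \<or> i - 1 \<in> {2..n - 2}" by auto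
    then show "r \<otimes> conjg (s [^] (i - 1)) a = conjg (s [^] (i - 1)) a \<otimes> r"
      using T by blast
  next
    have "s [^] (2 - 1 :: nat) = s" using c by simp
    then show "r \<otimes> (conjg (s [^] (2 - 1 :: nat)) a \<otimes> r) =
        conjg (s [^] (2 - 1 :: nat)) a \<otimes> (r \<otimes> conjg (s [^] (2 - 1 :: nat)) a)"
      using T by metis
  qed
  show "word_eval G f (three_word n x) = g x"
  proof (cases x)
    case G\<sigma>\<^sub>1
    then show ?thesis using c f_Sig[of 1] by (simp add: a_def)
  next
    case G\<sigma>
    then show ?thesis
      using word_eval_Sig_prod[OF f, of "n - 1"] n prod by (simp add: f_Sig s_def)
  next
    case G\<rho>
    then show ?thesis using c f_Rho by (simp add: r_def)
  qed
qed

end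

section \<open>Assembly of the Artin and Coxeter presentations\<close>

lemma UNIV_three_gen: "{G\<sigma>\<^sub>1, G\<sigma>, G\<rho>} = UNIV"
proof -
  have "x \<in> {G\<sigma>\<^sub>1, G\<sigma>, G\<rho>}" for x by (cases x) auto
  then show ?thesis by blast
qed

lemma words_UNIV: "words UNIV = UNIV"
  by (simp add: words_def)

lemma D_braid_rels_words: "3 \<le> n \<Longrightarrow> D_braid_rels n \<subseteq> words (D_gens n) \<times> words (D_gens n)"
  by (auto simp: D_braid_rels_def D_gens_def)

lemma D_coxeter_rels_words: "3 \<le> n \<Longrightarrow> D_coxeter_rels n \<subseteq> words (D_gens n) \<times> words (D_gens n)"
  using D_braid_rels_words[of n] by (auto simp: D_coxeter_rels_def)

text \<open>Common to both groups: the braid relations have been translated once and for all, so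
  only relations of \<open>R\<close> and \<open>S\<close> beyond them remain to be checked.\<close>

lemma has_presentation_three_gens:
  fixes n :: nat and R S
  defines "P \<equiv> presented_group UNIV R" and "Q \<equiv> presented_group (D_gens n) S"
  assumes n: "3 \<le> n"
    and S: "D_braid_rels n \<subseteq> S" "S \<subseteq> words (D_gens n) \<times> words (D_gens n)"
    and R: "three_braid_rels n \<subseteq> R"
    and fw: "\<And>u v. (u, v) \<in> R - three_braid_rels n \<Longrightarrow>
      word_eval Q (\<lambda>x. pres_class (D_gens n) S (three_word n x)) u =
      word_eval Q (\<lambda>x. pres_class (D_gens n) S (three_word n x)) v"
    and bw: "\<And>u v. (u, v) \<in> S - D_braid_rels n \<Longrightarrow>
      word_eval P (\<lambda>y. pres_class UNIV R (D_gen_word y)) u =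
      word_eval P (\<lambda>y. pres_class UNIV R (D_gen_word y)) v"
  shows "has_presentation Q {G\<sigma>\<^sub>1, G\<sigma>, G\<rho>} R (\<lambda>x. pres_class (D_gens n) S (three_word n x))"
proof -
  interpret P: group P unfolding P_def by (rule group_presented_group)
  interpret Q: group Q unfolding Q_def by (rule group_presented_group)
  have R': "R \<subseteq> words UNIV \<times> words UNIV" by (simp add: words_UNIV)
  let ?f = "\<lambda>y. pres_class (D_gens n) S (gen y)" and ?g = "\<lambda>x. pres_class UNIV R (gen x)"
  have f: "?f \<in> D_gens n \<rightarrow> carrier Q" and g: "?g \<in> UNIV \<rightarrow> carrier P"
    by (auto simp: P_def Q_def intro!: pres_class_closed)
  \<comment> \<open>With \<open>?f\<close> and \<open>?g\<close> the tautological assignments of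
    generators, evaluating the substituted words gives their classes. The two translation lemmas
    then become the premises of \<open>has_presentation_presented_groupI\<close>.\<close>
  have f': "word_eval Q ?f (three_word n x) = pres_class (D_gens n) S (three_word n x)" for x
    unfolding Q_def by (rule word_eval_presented_group[OF three_word_closed[OF n]])
  have g': "word_eval P ?g (D_gen_word y) = pres_class UNIV R (D_gen_word y)" for y
    unfolding P_def by (rule word_eval_presented_group) (simp add: words_UNIV)
  have fr: "\<forall>(u, v) \<in> D_braid_rels n. word_eval Q ?f u = word_eval Q ?f v"
    unfolding Q_def using presented_group_rel[OF S(2)] S(1) by blast
  have gr: "\<forall>(u, v) \<in> three_braid_rels n. word_eval P ?g u = word_eval P ?g v"
    unfolding P_def using presented_group_rel[OF R'] R by blast
  note fw' = Q.three_braid_rels_if_D_braid_rels[OF n f fr, unfolded f']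
  note bw' = P.D_braid_rels_if_three_braid_rels[OF n g gr, unfolded g']
  show ?thesis
    unfolding UNIV_three_gen Q_def
  proof (rule has_presentation_presented_groupI[where bw = D_gen_word], fold P_def Q_def)
    show "word_eval Q (\<lambda>x. pres_class (D_gens n) S (three_word n x)) u =
        word_eval Q (\<lambda>x. pres_class (D_gens n) S (three_word n x)) v" if "(u, v) \<in> R" for u v
      using fw'(1) fw that by blast
    show "word_eval P (\<lambda>y. pres_class UNIV R (D_gen_word y)) u =
        word_eval P (\<lambda>y. pres_class UNIV R (D_gen_word y)) v" if "(u, v) \<in> S" for u v
      using bw'(1) bw that by blast
  qed (use fw'(2) bw'(2) three_word_closed[OF n] in \<open>simp_all add: words_UNIV\<close>)
qed

lemma pres_class_square:
  assumes "(wpow w 2, []) \<in> R" "w \<in> words X"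
  shows "pres_class X R w [^]\<^bsub>presented_group X R\<^esub> (2::nat) = \<one>\<^bsub>presented_group X R\<^esub>"
proof -
  interpret P: group "presented_group X R" by (rule group_presented_group)
  have "pres_eq X R (w @ w) []"
    using assms by (intro pres_eq.rel) (auto simp: numeral_2_eq_2)
  then show ?thesis
    using assms(2)
    by (simp add: pres_class_closed numeral_2_eq_2 pres_class_mult one_presented_group
        pres_class_eq_iff)
qed

text \<open>The added squares of \<sigma>_1 and \<rho> are squares of canonical generators.
  Conversely each \<sigma>_i is conjugate to \<sigma>_1, so its square is trivial as soon as that of
  \<sigma>_1 is.\<close>

lemma has_presentation_Cox_D:
  assumes n: "3 \<le> n"
  shows "has_presentation (Cox_D n) {G\<sigma>\<^sub>1, G\<sigma>, G\<rho>} (three_coxeter_rels n)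
    (\<lambda>x. pres_class (D_gens n) (D_coxeter_rels n) (three_word n x))"
  unfolding Cox_D_def
proof (rule has_presentation_three_gens)
  let ?S = "D_coxeter_rels n" and ?R = "three_coxeter_rels n"
  let ?Q = "presented_group (D_gens n) ?S" and ?P = "presented_group UNIV ?R"
  let ?f = "\<lambda>x. pres_class (D_gens n) ?S (three_word n x)"
  let ?g = "\<lambda>y. pres_class UNIV ?R (D_gen_word y)"
  interpret P: group ?P by (rule group_presented_group)
  interpret Q: group ?Q by (rule group_presented_group)
  have f: "?f \<in> UNIV \<rightarrow> carrier ?Q" and g: "?g \<in> D_gens n \<rightarrow> carrier ?P"
    using three_word_closed[OF n] by (auto intro!: pres_class_closed simp: words_UNIV)
  show "word_eval ?Q ?f u = word_eval ?Q ?f v" if "(u, v) \<in> ?R - three_braid_rels n" for u v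
  proof -
    \<comment> \<open>The squared generators are precisely those that \<open>three_word\<close>
      sends to a single letter, so each new relation is already one of \<open>?S\<close>.\<close>
    obtain x y where x: "u = wpow (gen x) 2" "v = []" "three_word n x = gen y" "y \<in> D_gens n"
    proof -
      from \<open>(u, v) \<in> ?R - three_braid_rels n\<close>
      consider "u = wpow (gen G\<sigma>\<^sub>1) 2" "v = []" | "u = wpow (gen G\<rho>) 2" "v = []"
        by (auto simp: three_coxeter_rels_def)
      then show thesis
        using n that[of "G\<sigma>\<^sub>1" "Sig 1"] that[of "G\<rho>" Rho] by cases (auto simp: D_gens_def)
    qed
    then have "(wpow (gen y) 2, []) \<in> ?S" by (auto simp: D_coxeter_rels_def)
    then have "?f x [^]\<^bsub>?Q\<^esub> (2::nat) = \<one>\<^bsub>?Q\<^esub>"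
      using x by (simp add: pres_class_square)
    then show ?thesis
      using Q.word_eval_wpow[OF f, of "gen x" 2] Q.word_eval_gen[of ?f x, OF funcset_mem[OF f UNIV_I]]
      by (simp add: words_UNIV x(1,2))
  qed
  show "word_eval ?P ?g u = word_eval ?P ?g v" if "(u, v) \<in> ?S - D_braid_rels n" for u v
  proof -
    obtain y where y: "u = wpow (gen y) 2" "v = []" "y \<in> D_gens n"
      using \<open>(u, v) \<in> ?S - D_braid_rels n\<close> unfolding D_coxeter_rels_def by blast
    let ?h = "\<lambda>x. pres_class UNIV ?R (gen x)"
    have h: "?h \<in> UNIV \<rightarrow> carrier ?P" by (auto intro!: pres_class_closed)
    have hc: "?h x \<in> carrier ?P" for x using h by blast
    have sq: "?h x \<otimes>\<^bsub>?P\<^esub> ?h x = \<one>\<^bsub>?P\<^esub>" if "x = G\<sigma>\<^sub>1 \<or> x = G\<rho>" for x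
    proof -
      have "(wpow (gen x) 2, []) \<in> ?R" using that by (auto simp: three_coxeter_rels_def)
      then have "?h x [^]\<^bsub>?P\<^esub> (2::nat) = \<one>\<^bsub>?P\<^esub>"
        by (rule pres_class_square) simp
      then show ?thesis using hc[of x] by (simp add: numeral_2_eq_2)
    qed
    have "?g y \<otimes>\<^bsub>?P\<^esub> ?g y = \<one>\<^bsub>?P\<^esub>"
    proof (cases y)
      case (Sig i)
      \<comment> \<open>Once the class is written as a conjugate, its square is the conjugate of a
        trivial square.\<close>
      have "?g y = word_eval ?P ?h (sigma_conj (i - 1))"
        using Sig by (simp add: D_gen_word_def word_eval_presented_group words_UNIV)
      also have "\<dots> = P.conjg (?h G\<sigma> [^]\<^bsub>?P\<^esub> (i - 1)) (?h G\<sigma>\<^sub>1)"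
        by (rule P.word_eval_sigma_conj[OF h])
      finally show ?thesis
        using sq[of "G\<sigma>\<^sub>1"] hc
        by (simp only: P.conjg_mult[symmetric] P.nat_pow_closed P.conjg_of_one simp_thms)
    next
      case Rho
      then show ?thesis using sq[of "G\<rho>"] by (simp add: D_gen_word_def)
    qed
    moreover have "?g y \<in> carrier ?P" using g y(3) by blast
    ultimately show ?thesis
      using P.word_eval_wpow[OF g, of "gen y" 2] P.word_eval_gen[of ?g y] y(3)
      unfolding y(1,2) by (simp add: numeral_2_eq_2)
  qed
qed (use n D_coxeter_rels_words in \<open>auto simp: D_coxeter_rels_def three_coxeter_rels_def\<close>)

theorem mainTheorem5:
  fixes n :: nat
  assumes "n \<ge> 3"
  shows "has_presentation (Br_D n) {G\<sigma>\<^sub>1, G\<sigma>, G\<rho>} (three_braid_rels n)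
           (\<lambda>x. pres_class (D_gens n) (D_braid_rels n) (three_word n x)) \<and>
         has_presentation (Cox_D n) {G\<sigma>\<^sub>1, G\<sigma>, G\<rho>} (three_coxeter_rels n)
           (\<lambda>x. pres_class (D_gens n) (D_coxeter_rels n) (three_word n x))"
  \<comment> \<open>For the Artin group both inclusions of relations are equalities, so there are no
    additional relations to check.\<close>
  using has_presentation_Cox_D[OF assms]
    has_presentation_three_gens[OF assms order_refl D_braid_rels_words[OF assms] order_refl]
  by (simp add: Br_D_def)

end
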